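(* Let $(E,A)$ be a system. For any integer $k\ge1$, $$\dim \Delta V^{(k)}=\sum_{j\ge k}(\alpha_j+\beta_j^+),\qquad \dim\Delta M^{(k)}=\sum_{j\ge k}(\alpha_j+\beta^+_{j+1}),$$ where $\Delta M^{(k)}=M^{(k-1)}/M^{(k)}$ and $\Delta V^{(k)}=V^{(k-1)}/V^{(k)}$.
   Context: Fix a field $\mathbb K$. A system $(E,A)$ is a pair of $\mathbb K$-linear maps $E,A:M\to V$ with the same finite-dimensional domain $M$ and the same finite-dimensional codomain $V$. Reduction: put $V'=EM$ and $M'=A^{-1}V'=\{x\in M: Ax\in V'\}$. Then $E$ and $A$ map $M'$ into $V'$; let $E',A':M'\to V'$ be the restrictions. The reduced system is $(E,A)'=(E',A')$. Define $(E^{(0)},A^{(0)})=(E,A)$ and $(E^{(k+1)},A^{(k+1)})=(E^{(k)},A^{(k)})'$, with domain $M^{(k)}$ and codomain $V^{(k)}$ of $(E^{(k)},A^{(k)})$; so $V''=V^{(2)}=EM'$. Defects: let $[A]:M/M'\to V/V'$ and $[E]:M/M'\to V'/V''$ be the maps induced by $A$ and $E$ on the quotients. Put $\beta_1^+(E,A)=\dim\operatorname{coker}[A]$, $\alpha_1(E,A)=\dim\ker[E]$, and for $k\ge1$, $\alpha_k=\alpha_k(E,A)=\alpha_1(E^{(k-1)},A^{(k-1)})$, $\beta^+_k=\beta^+_k(E,A)=\beta^+_1(E^{(k-1)},A^{(k-1)})$. *)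

theory Defs
  imports "HOL-Analysis.Infinite_Sum" "HOL-Algebra.AbelCoset" "Jordan_Normal_Form.Missing_VectorSpace"
begin

text \<open>
  Vector spaces are the carrier-based ones of the AFP entry VectorSpace (locale \<open>vectorspace\<close>, built
  on \<open>HOL-Algebra\<close> modules), together with its \<open>linear_map\<close>, \<open>fin_dim\<close> and \<open>dim\<close>.
\<close>

text \<open>
  The quotient of \<open>V\<close> by a subspace with carrier \<open>N\<close>; its elements are the cosets of \<open>N\<close>.
  In the scalar multiplication the coset of \<open>N\<close> has to be taken explicitly, since for the scalar
  zero the pointwise multiples of a coset do not form a coset.  The ring multiplication and unit
  carried by the record type of modules play no role.
\<close>

definition quot_vs :: "('a, 'm, 'x) module_scheme \<Rightarrow> 'm set \<Rightarrow> ('a, 'm set) module" where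
  "quot_vs V N =
     \<lparr>carrier = a_rcosets\<^bsub>V\<^esub> N,
      monoid.mult = undefined,
      one = undefined,
      zero = N,
      add = (\<lambda>X Y. X <+>\<^bsub>V\<^esub> Y),
      smult = (\<lambda>c X. \<Union>x\<in>X. N +>\<^bsub>V\<^esub> (c \<odot>\<^bsub>V\<^esub> x))\<rparr>"

text \<open>
  The map into the quotient of \<open>W\<close> by \<open>N\<close> induced by \<open>f\<close> on cosets: if \<open>f\<close> carries the subspace
  factored out in the domain into \<open>N\<close>, all cosets in the union coincide.
\<close>

definition induced_map ::
    "('a, 'v, 'x) module_scheme \<Rightarrow> 'v set \<Rightarrow> ('m \<Rightarrow> 'v) \<Rightarrow> 'm set \<Rightarrow> 'v set" where
  "induced_map W N f X = (\<Union>x\<in>X. N +>\<^bsub>W\<^esub> f x)"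

definition kernel_vs ::
    "('a, 'm) module \<Rightarrow> ('a, 'v) module \<Rightarrow> ('m \<Rightarrow> 'v) \<Rightarrow> ('a, 'm) module" where
  "kernel_vs M W f = M\<lparr>carrier := mod_hom.ker M W f\<rparr>"

definition cokernel_vs ::
    "('a, 'm) module \<Rightarrow> ('a, 'v) module \<Rightarrow> ('m \<Rightarrow> 'v) \<Rightarrow> ('a, 'v set) module" where
  "cokernel_vs M W f = quot_vs W (mod_hom.im M f)"

record ('a, 'm, 'v) system =
  dom_sp :: "('a, 'm) module"
  cod_sp :: "('a, 'v) module"
  E_map :: "'m \<Rightarrow> 'v"
  A_map :: "'m \<Rightarrow> 'v"

definition is_system :: "('a, 'k) ring_scheme \<Rightarrow> ('a, 'm, 'v) system \<Rightarrow> bool" where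
  "is_system K S \<longleftrightarrow>
     linear_map K (dom_sp S) (cod_sp S) (E_map S) \<and>
     linear_map K (dom_sp S) (cod_sp S) (A_map S) \<and>
     vectorspace.fin_dim K (dom_sp S) \<and>
     vectorspace.fin_dim K (cod_sp S)"

definition reduced_cod :: "('a, 'm, 'v) system \<Rightarrow> 'v set" where
  "reduced_cod S = E_map S ` carrier (dom_sp S)"

definition reduced_dom :: "('a, 'm, 'v) system \<Rightarrow> 'm set" where
  "reduced_dom S = {x \<in> carrier (dom_sp S). A_map S x \<in> reduced_cod S}"

definition reduced :: "('a, 'm, 'v) system \<Rightarrow> ('a, 'm, 'v) system" where
  "reduced S =
     \<lparr>dom_sp = (dom_sp S)\<lparr>carrier := reduced_dom S\<rparr>,
      cod_sp = (cod_sp S)\<lparr>carrier := reduced_cod S\<rparr>,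
      E_map = restrict (E_map S) (reduced_dom S),
      A_map = restrict (A_map S) (reduced_dom S)\<rparr>"

definition iter_reduced :: "('a, 'm, 'v) system \<Rightarrow> nat \<Rightarrow> ('a, 'm, 'v) system" where
  "iter_reduced S k = (reduced ^^ k) S"

abbreviation M_iter :: "('a, 'm, 'v) system \<Rightarrow> nat \<Rightarrow> ('a, 'm) module" where
  "M_iter S k \<equiv> dom_sp (iter_reduced S k)"

abbreviation V_iter :: "('a, 'm, 'v) system \<Rightarrow> nat \<Rightarrow> ('a, 'v) module" where
  "V_iter S k \<equiv> cod_sp (iter_reduced S k)"

text \<open>
  The quotients of consecutive terms of the reduction sequence, meaningful for \<open>k \<ge> 1\<close>.
\<close>

definition Delta_M :: "('a, 'm, 'v) system \<Rightarrow> nat \<Rightarrow> ('a, 'm set) module" where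
  "Delta_M S k = quot_vs (M_iter S (k - 1)) (carrier (M_iter S k))"

definition Delta_V :: "('a, 'm, 'v) system \<Rightarrow> nat \<Rightarrow> ('a, 'v set) module" where
  "Delta_V S k = quot_vs (V_iter S (k - 1)) (carrier (V_iter S k))"

text \<open>The induced maps \<open>[A] : M/M' \<rightarrow> V/V'\<close> and \<open>[E] : M/M' \<rightarrow> V'/V''\<close>.\<close>

definition A_ind :: "('a, 'm, 'v) system \<Rightarrow> 'm set \<Rightarrow> 'v set" where
  "A_ind S = induced_map (V_iter S 0) (carrier (V_iter S 1)) (A_map S)"

definition E_ind :: "('a, 'm, 'v) system \<Rightarrow> 'm set \<Rightarrow> 'v set" where
  "E_ind S = induced_map (V_iter S 1) (carrier (V_iter S 2)) (E_map S)"

definition beta1 :: "('a, 'k) ring_scheme \<Rightarrow> ('a, 'm, 'v) system \<Rightarrow> nat" where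
  "beta1 K S = vectorspace.dim K (cokernel_vs (Delta_M S 1) (Delta_V S 1) (A_ind S))"

definition alpha1 :: "('a, 'k) ring_scheme \<Rightarrow> ('a, 'm, 'v) system \<Rightarrow> nat" where
  "alpha1 K S = vectorspace.dim K (kernel_vs (Delta_M S 1) (Delta_V S 2) (E_ind S))"

text \<open>The defects \<open>\<alpha>\<^sub>k\<close> and \<open>\<beta>\<^sub>k\<^sup>+\<close>, meaningful for \<open>k \<ge> 1\<close>.\<close>

definition alpha :: "('a, 'k) ring_scheme \<Rightarrow> ('a, 'm, 'v) system \<Rightarrow> nat \<Rightarrow> nat" where
  "alpha K S k = alpha1 K (iter_reduced S (k - 1))"

definition beta :: "('a, 'k) ring_scheme \<Rightarrow> ('a, 'm, 'v) system \<Rightarrow> nat \<Rightarrow> nat" where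
  "beta K S k = beta1 K (iter_reduced S (k - 1))"

end

theory Submission
  imports Defs
begin

text \<open>
  Since \<open>M' = A\<^sup>-\<^sup>1 V'\<close>, the map \<open>[A]\<close> is injective, and since \<open>V' = E M\<close>, the map \<open>[E]\<close> is
  surjective. Rank-nullity therefore gives \<open>\<beta>\<^sub>j\<^sup>+ = dim \<Delta>V\<^sub>j - dim \<Delta>M\<^sub>j\<close> and
  \<open>\<alpha>\<^sub>j = dim \<Delta>M\<^sub>j - dim \<Delta>V\<^sub>j\<^sub>+\<^sub>1\<close>, so both sums telescope. They stop because the dimensions of
  the \<open>V\<^sub>j\<close> decrease and hence stabilise.
\<close>

section \<open>Quotients of vector spaces\<close>

text \<open>Sets independent in \<open>N\<close> remain independent in \<open>V\<close>, so
  \<open>dim\<close> bounds their size. Hence a maximal one exists, and it is a finite basis of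
  \<open>N\<close>.\<close>

lemma (in vectorspace) subspace_fin_dim:
  assumes fd: fin_dim and N: "subspace K N V"
  shows "vectorspace.fin_dim K (V\<lparr>carrier := N\<rparr>)"
proof -
  interpret N: vectorspace K "V\<lparr>carrier := N\<rparr>"
    using N by (rule subspace_is_vs)
  have sm: "submodule K N V" and sub: "N \<subseteq> carrier V"
    using N by (auto simp: subspace_def submodule_def)
  have "finite A \<and> card A \<le> dim" if "A \<subseteq> N \<and> N.lin_indpt A" for A
  proof -
    have "lin_indpt A" using span_li_not_depend(2)[OF _ sm, of A] that by auto
    then show ?thesis using li_le_dim[OF fd] that sub by auto
  qed
  moreover have "{} \<subseteq> N \<and> N.lin_indpt {}" by (simp add: N.lin_dep_def)
  ultimately obtain A where "finite A" and max: "maximal A (\<lambda>A. A \<subseteq> N \<and> N.lin_indpt A)"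
    using maximal_exists[of "\<lambda>A. A \<subseteq> N \<and> N.lin_indpt A" dim "{}"] by blast
  then have "N.basis A" using N.max_li_is_basis[of A] by simp
  then show ?thesis
    using \<open>finite A\<close> unfolding N.fin_dim_def N.basis_def by auto
qed

text \<open>Opens the coset calculus of abelian groups to subspaces. Negatives stay in
  \<open>N\<close> because they are multiples by -1.\<close>

lemma subspace_abelian_subgroup:
  assumes "subspace K N V"
  shows "abelian_subgroup N V"
proof -
  interpret V: vectorspace K V using assms by (simp add: subspace_def)
  have N: "submodule K N V" using assms by (simp add: subspace_def)
  show ?thesis
  proof (intro abelian_subgroupI3 additive_subgroupI)
    show "subgroup N (add_monoid V)"
    proof (rule subgroup.intro)
      fix x assume x: "x \<in> N"
      then have "x \<in> carrier V" using N by (auto simp: submodule_def)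
      then have "\<ominus>\<^bsub>V\<^esub> x \<in> N"
        using x V.smult_minus_1 submodule.smult_closed[OF N] by (metis V.R.a_inv_closed V.R.one_closed)
      then show "inv\<^bsub>add_monoid V\<^esub> x \<in> N" by (simp add: a_inv_def)
    qed (use N in \<open>auto simp: submodule_def\<close>)
  qed (rule V.M.abelian_group_axioms)
qed

locale vs_quotient =
  fixes K (structure) and V and N
  assumes subspace: "subspace K N V"
begin

sublocale V: vectorspace K V
  using subspace by (simp add: subspace_def)

sublocale abelian_subgroup N V
  using subspace by (rule subspace_abelian_subgroup)

lemma smult_mem: "c \<in> carrier K \<Longrightarrow> x \<in> N \<Longrightarrow> c \<odot>\<^bsub>V\<^esub> x \<in> N"
  using subspace by (auto simp: subspace_def submodule_def)

lemma coset_memE: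
  assumes "y \<in> N +>\<^bsub>V\<^esub> x"
  obtains n where "n \<in> N" "y = n \<oplus>\<^bsub>V\<^esub> x"
  using assms by (auto simp: a_r_coset_def')

lemma coset_eq_iff:
  assumes "x \<in> carrier V" "y \<in> carrier V"
  shows "N +>\<^bsub>V\<^esub> x = N +>\<^bsub>V\<^esub> y \<longleftrightarrow> x \<ominus>\<^bsub>V\<^esub> y \<in> N"
proof
  assume "N +>\<^bsub>V\<^esub> x = N +>\<^bsub>V\<^esub> y"
  then have "x \<in> N +>\<^bsub>V\<^esub> y" using a_rcos_self[OF assms(1)] by simp
  then obtain n where "n \<in> N" "x = n \<oplus>\<^bsub>V\<^esub> y" by (rule coset_memE)
  moreover have "n \<in> carrier V" using \<open>n \<in> N\<close> a_subset by auto
  ultimately show "x \<ominus>\<^bsub>V\<^esub> y \<in> N"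
    using assms by (simp add: a_minus_def V.M.a_assoc V.M.r_neg)
next
  assume d: "x \<ominus>\<^bsub>V\<^esub> y \<in> N"
  \<comment> \<open>Written as an element of \<open>N\<close> plus \<open>y\<close>, the vector
    \<open>x\<close> lies in the coset of \<open>y\<close>, and a coset is determined by any of its
    members.\<close>
  have "x = (x \<ominus>\<^bsub>V\<^esub> y) \<oplus>\<^bsub>V\<^esub> y"
    using assms by (simp add: a_minus_def V.M.a_assoc V.M.l_neg)
  then have "x \<in> N +>\<^bsub>V\<^esub> y"
    using d assms a_subset V.M.a_rcosI by metis
  then show "N +>\<^bsub>V\<^esub> x = N +>\<^bsub>V\<^esub> y"
    using V.M.a_repr_independence[OF _ assms(2) a_subgroup] by simp
qed

lemma coset_eq_self_iff:
  "x \<in> carrier V \<Longrightarrow> N +>\<^bsub>V\<^esub> x = N \<longleftrightarrow> x \<in> N"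
  using V.M.a_coset_join1[OF _ _ a_subgroup] V.M.a_coset_join2[OF _ a_subgroup] by blast

lemma carrier_quot_vs: "carrier (quot_vs V N) = (\<lambda>x. N +>\<^bsub>V\<^esub> x) ` carrier V"
  by (auto simp: quot_vs_def A_RCOSETS_def')

lemma zero_quot_vs: "\<zero>\<^bsub>quot_vs V N\<^esub> = N"
  by (simp add: quot_vs_def)

lemma coset_mem_quot_vs [intro]: "x \<in> carrier V \<Longrightarrow> N +>\<^bsub>V\<^esub> x \<in> carrier (quot_vs V N)"
  by (auto simp: carrier_quot_vs)

lemma add_quot_vs:
  "x \<in> carrier V \<Longrightarrow> y \<in> carrier V \<Longrightarrow>
    (N +>\<^bsub>V\<^esub> x) \<oplus>\<^bsub>quot_vs V N\<^esub> (N +>\<^bsub>V\<^esub> y) = N +>\<^bsub>V\<^esub> (x \<oplus>\<^bsub>V\<^esub> y)"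
  by (simp add: quot_vs_def a_rcos_sum)

text \<open>All members of the union defining \<open>induced_map\<close> coincide: two points of a
  coset of \<open>P\<close> differ by some \<open>p\<close> in \<open>P\<close>, and
  \<open>f p\<close> lies in \<open>N\<close>.\<close>

lemma induced_map_coset:
  assumes f: "linear_map K M V f" and P: "subspace K P M" and fP: "f ` P \<subseteq> N"
    and x: "x \<in> carrier M"
  shows "induced_map V N f (P +>\<^bsub>M\<^esub> x) = N +>\<^bsub>V\<^esub> f x"
proof -
  interpret f: linear_map K M V f by (rule f)
  interpret P: abelian_subgroup P M using P by (rule subspace_abelian_subgroup)
  have "N +>\<^bsub>V\<^esub> f y = N +>\<^bsub>V\<^esub> f x" if y: "y \<in> P +>\<^bsub>M\<^esub> x" for y
  proof -
    obtain p where p: "p \<in> P" and y: "y = p \<oplus>\<^bsub>M\<^esub> x"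
      using y by (auto simp: a_r_coset_def')
    have "p \<in> carrier M" using p P.a_subset by auto
    then have "f y \<ominus>\<^bsub>V\<^esub> f x = f p"
      using x by (simp add: y a_minus_def V.M.a_assoc V.M.r_neg)
    then show ?thesis
      using p fP x \<open>p \<in> carrier M\<close> by (subst coset_eq_iff) (auto simp: y)
  qed
  then show ?thesis
    using P.a_rcos_self[OF x] unfolding induced_map_def by blast
qed

lemma smult_quot_vs:
  assumes c: "c \<in> carrier K" and x: "x \<in> carrier V"
  shows "c \<odot>\<^bsub>quot_vs V N\<^esub> (N +>\<^bsub>V\<^esub> x) = N +>\<^bsub>V\<^esub> (c \<odot>\<^bsub>V\<^esub> x)"
proof -
  \<comment> \<open>Scalar multiplication in \<open>quot_vs\<close> has the form of a map induced by
    multiplication by \<open>c\<close>, which sends \<open>N\<close> into itself. So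
    \<open>induced_map_coset\<close> computes it, with \<open>N\<close> factored out on both
    sides.\<close>
  have "linear_map K V V (\<lambda>x. c \<odot>\<^bsub>V\<^esub> x)"
    using c by unfold_locales (auto simp: module_hom_def V.smult_r_distr V.smult_assoc_simp V.R.m_comm)
  then show ?thesis
    using induced_map_coset[OF _ subspace _ x, of "\<lambda>x. c \<odot>\<^bsub>V\<^esub> x"] smult_mem[OF c]
    by (simp add: quot_vs_def induced_map_def image_subset_iff)
qed

text \<open>Every element is the coset of a representative and the operations act on
  representatives, so each axiom is inherited from \<open>V\<close>.\<close>

lemma vectorspace_quot_vs: "vectorspace K (quot_vs V N)"
proof (rule vs_criteria)
  show "field K" ..
  show "\<zero>\<^bsub>quot_vs V N\<^esub> \<in> carrier (quot_vs V N)"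
    using coset_mem_quot_vs[of "\<zero>\<^bsub>V\<^esub>"] a_subset by (simp add: zero_quot_vs)
  show "\<forall>v\<in>carrier (quot_vs V N). \<exists>w\<in>carrier (quot_vs V N). v \<oplus>\<^bsub>quot_vs V N\<^esub> w = \<zero>\<^bsub>quot_vs V N\<^esub>"
  proof
    fix v assume "v \<in> carrier (quot_vs V N)"
    then obtain x where x: "x \<in> carrier V" "v = N +>\<^bsub>V\<^esub> x" by (auto simp: carrier_quot_vs)
    then have "v \<oplus>\<^bsub>quot_vs V N\<^esub> (N +>\<^bsub>V\<^esub> (\<ominus>\<^bsub>V\<^esub> x)) = \<zero>\<^bsub>quot_vs V N\<^esub>"
      using a_subset by (simp add: add_quot_vs zero_quot_vs V.M.r_neg)
    then show "\<exists>w\<in>carrier (quot_vs V N). v \<oplus>\<^bsub>quot_vs V N\<^esub> w = \<zero>\<^bsub>quot_vs V N\<^esub>"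
      using x by blast
  qed
  show "\<forall>v\<in>carrier (quot_vs V N). v \<oplus>\<^bsub>quot_vs V N\<^esub> \<zero>\<^bsub>quot_vs V N\<^esub> = v"
  proof
    fix v assume "v \<in> carrier (quot_vs V N)"
    then obtain x where x: "x \<in> carrier V" "v = N +>\<^bsub>V\<^esub> x" by (auto simp: carrier_quot_vs)
    then show "v \<oplus>\<^bsub>quot_vs V N\<^esub> \<zero>\<^bsub>quot_vs V N\<^esub> = v"
      using add_quot_vs[of x "\<zero>\<^bsub>V\<^esub>"] a_subset by (simp add: zero_quot_vs)
  qed
qed (auto simp: carrier_quot_vs add_quot_vs smult_quot_vs V.M.a_ac V.smult_l_distr V.smult_r_distr V.smult_assoc1)

lemma linear_map_coset: "linear_map K V (quot_vs V N) (\<lambda>x. N +>\<^bsub>V\<^esub> x)"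
proof -
  interpret Q: vectorspace K "quot_vs V N" by (rule vectorspace_quot_vs)
  show ?thesis
    by unfold_locales (auto simp: module_hom_def carrier_quot_vs add_quot_vs smult_quot_vs)
qed

text \<open>Rank-nullity for the projection onto the quotient, which is surjective with kernel
  \<open>N\<close>.\<close>

lemma quot_vs_fin_dim:
  assumes "V.fin_dim"
  shows "vectorspace.fin_dim K (quot_vs V N)"
    and "vectorspace.dim K (quot_vs V N) + vectorspace.dim K (V\<lparr>carrier := N\<rparr>) = V.dim"
proof -
  interpret \<pi>: linear_map K V "quot_vs V N" "\<lambda>x. N +>\<^bsub>V\<^esub> x" by (rule linear_map_coset)
  have surj: "(\<lambda>x. N +>\<^bsub>V\<^esub> x) ` carrier V = carrier (quot_vs V N)"
    by (simp add: carrier_quot_vs)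
  show "vectorspace.fin_dim K (quot_vs V N)"
    using \<pi>.surj_fin_dim[OF assms surj] .
  have "x \<in> \<pi>.ker \<longleftrightarrow> x \<in> N" for x
    unfolding \<pi>.ker_def zero_quot_vs using a_subset coset_eq_self_iff[of x] by blast
  then have "\<pi>.ker = N" by blast
  moreover have "\<pi>.im = carrier (quot_vs V N)"
    by (simp add: \<pi>.im_def surj)
  ultimately show "vectorspace.dim K (quot_vs V N) + vectorspace.dim K (V\<lparr>carrier := N\<rparr>) = V.dim"
    using \<pi>.rank_nullity[OF assms] by simp
qed

lemma linear_map_induced_map:
  assumes f: "linear_map K M V f" and P: "subspace K P M" and fP: "f ` P \<subseteq> N"
  shows "linear_map K (quot_vs M P) (quot_vs V N) (induced_map V N f)"
proof -
  interpret f: linear_map K M V f by (rule f)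
  interpret P: vs_quotient K M P by (rule vs_quotient.intro[OF P])
  have "induced_map V N f \<in> module_hom K (quot_vs M P) (quot_vs V N)"
    unfolding module_hom_def P.carrier_quot_vs
    by (auto intro!: coset_mem_quot_vs simp: P.add_quot_vs P.smult_quot_vs add_quot_vs smult_quot_vs induced_map_coset[OF assms])
  then show ?thesis
    using P.vectorspace_quot_vs vectorspace_quot_vs
    by (simp add: linear_map_def mod_hom_def mod_hom_axioms_def vectorspace_def)
qed

end

section \<open>Dimension of the cokernel of an injection and of the kernel of a surjection\<close>

lemma dim_cokernel_vs_inj:
  assumes f: "linear_map K M W f" and "vectorspace.fin_dim K M" "vectorspace.fin_dim K W"
    and inj: "inj_on f (carrier M)"
  shows "vectorspace.dim K (cokernel_vs M W f) + vectorspace.dim K M = vectorspace.dim K W"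
proof -
  interpret f: linear_map K M W f by (rule f)
  interpret im: vs_quotient K W f.im by (rule vs_quotient.intro[OF f.imT_is_subspace])
  \<comment> \<open>Injectivity makes the kernel zero-dimensional, so the image has the full
    dimension of \<open>M\<close>; the cokernel is the quotient of \<open>W\<close> by this
    image.\<close>
  have "vectorspace.dim K (W\<lparr>carrier := f.im\<rparr>) = vectorspace.dim K M"
    using f.rank_nullity[OF assms(2)] f.inj_imp_dim_ker0[OF inj] by simp
  then show ?thesis
    using im.quot_vs_fin_dim(2)[OF assms(3)] by (simp add: cokernel_vs_def)
qed

lemma dim_kernel_vs_surj:
  assumes f: "linear_map K M W f" and "vectorspace.fin_dim K M"
    and surj: "f ` carrier M = carrier W"
  shows "vectorspace.dim K (kernel_vs M W f) + vectorspace.dim K W = vectorspace.dim K M"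
proof -
  interpret f: linear_map K M W f by (rule f)
  show ?thesis
    using f.rank_nullity[OF assms(2)] surj by (simp add: kernel_vs_def f.im_def add.commute)
qed

section \<open>Reduction of systems\<close>

lemma iter_reduced_add: "iter_reduced (iter_reduced S j) i = iter_reduced S (i + j)"
  by (simp add: iter_reduced_def funpow_add)

lemma iter_reduced_Suc: "iter_reduced S (Suc j) = reduced (iter_reduced S j)"
  by (simp add: iter_reduced_def)

lemma iter_reduced_0: "iter_reduced S 0 = S"
  by (simp add: iter_reduced_def)

locale linear_system =
  fixes K (structure) and S
  assumes system: "is_system K S"
begin

sublocale E: linear_map K "dom_sp S" "cod_sp S" "E_map S"
  using system by (simp add: is_system_def)

sublocale A: linear_map K "dom_sp S" "cod_sp S" "A_map S"
  using system by (simp add: is_system_def)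

lemma fin_dim: "E.V.fin_dim" "E.W.fin_dim"
  using system by (auto simp: is_system_def)

lemma subspace_reduced_cod: "subspace K (reduced_cod S) (cod_sp S)"
  using E.imT_is_subspace by (simp add: reduced_cod_def E.im_def)

text \<open>The preimage of a subspace under the linear map \<open>A_map S\<close> is a
  subspace.\<close>

lemma subspace_reduced_dom: "subspace K (reduced_dom S) (dom_sp S)"
proof -
  have "submodule K (reduced_cod S) (cod_sp S)"
    using subspace_reduced_cod by (simp add: subspace_def)
  then have "submodule K (reduced_dom S) (dom_sp S)"
    by (auto simp: submodule_def reduced_dom_def E.V.module.module_axioms)
  then show ?thesis
    by (simp add: subspace_def E.V.vectorspace_axioms)
qed

text \<open>This is what allows the reduction to be iterated with every stage again a
  system.\<close>

lemma is_system_reduced: "is_system K (reduced S)"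
proof -
  interpret M': vectorspace K "(dom_sp S)\<lparr>carrier := reduced_dom S\<rparr>"
    by (rule E.V.subspace_is_vs[OF subspace_reduced_dom])
  interpret V': vectorspace K "(cod_sp S)\<lparr>carrier := reduced_cod S\<rparr>"
    by (rule E.W.subspace_is_vs[OF subspace_reduced_cod])
  \<comment> \<open>A restricted map agrees with the original one only on
    \<open>reduced_dom S\<close>, so additivity and homogeneity require sums and multiples to stay
    there.\<close>
  have closed: "x \<in> reduced_dom S \<Longrightarrow> y \<in> reduced_dom S \<Longrightarrow> x \<oplus>\<^bsub>dom_sp S\<^esub> y \<in> reduced_dom S"
    "c \<in> carrier K \<Longrightarrow> x \<in> reduced_dom S \<Longrightarrow> c \<odot>\<^bsub>dom_sp S\<^esub> x \<in> reduced_dom S" for x y c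
    using M'.M.add.m_closed M'.smult_closed by auto
  have dom: "x \<in> carrier (dom_sp S)" if "x \<in> reduced_dom S" for x
    using that by (simp add: reduced_dom_def)
  have "restrict f (reduced_dom S) \<in> module_hom K ((dom_sp S)\<lparr>carrier := reduced_dom S\<rparr>) ((cod_sp S)\<lparr>carrier := reduced_cod S\<rparr>)"
    if "linear_map K (dom_sp S) (cod_sp S) f" "f ` reduced_dom S \<subseteq> reduced_cod S" for f
  proof -
    interpret f: linear_map K "dom_sp S" "cod_sp S" f by (rule that(1))
    show ?thesis using that(2) closed dom by (auto simp: module_hom_def)
  qed
  moreover have "E_map S ` reduced_dom S \<subseteq> reduced_cod S" "A_map S ` reduced_dom S \<subseteq> reduced_cod S"
    by (auto simp: reduced_dom_def reduced_cod_def)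
  ultimately have "linear_map K (dom_sp (reduced S)) (cod_sp (reduced S)) (E_map (reduced S))"
    "linear_map K (dom_sp (reduced S)) (cod_sp (reduced S)) (A_map (reduced S))"
    unfolding reduced_def
    using E.linear_map_axioms A.linear_map_axioms M'.vectorspace_axioms V'.vectorspace_axioms
    by (simp_all add: linear_map_def mod_hom_def mod_hom_axioms_def vectorspace_def)
  then show ?thesis
    using E.V.subspace_fin_dim[OF fin_dim(1) subspace_reduced_dom]
      E.W.subspace_fin_dim[OF fin_dim(2) subspace_reduced_cod]
    by (simp add: is_system_def reduced_def)
qed

section \<open>The two dimension identities for a single reduction step\<close>

sublocale M: vs_quotient K "dom_sp S" "reduced_dom S"
  by (rule vs_quotient.intro[OF subspace_reduced_dom])

sublocale V: vs_quotient K "cod_sp S" "reduced_cod S"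
  by (rule vs_quotient.intro[OF subspace_reduced_cod])

lemma Delta_M_1: "Delta_M S (Suc 0) = quot_vs (dom_sp S) (reduced_dom S)"
  by (simp add: Delta_M_def iter_reduced_0 iter_reduced_Suc reduced_def)

lemma Delta_V_1: "Delta_V S (Suc 0) = quot_vs (cod_sp S) (reduced_cod S)"
  by (simp add: Delta_V_def iter_reduced_0 iter_reduced_Suc reduced_def)

lemma beta1_plus_dim_Delta_M:
  "beta1 K S + vectorspace.dim K (Delta_M S (Suc 0)) = vectorspace.dim K (Delta_V S (Suc 0))"
proof -
  have image: "A_map S ` reduced_dom S \<subseteq> reduced_cod S"
    unfolding reduced_dom_def by blast
  have A_ind: "A_ind S = induced_map (cod_sp S) (reduced_cod S) (A_map S)"
    by (simp add: A_ind_def iter_reduced_0 iter_reduced_Suc reduced_def)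
  note coset = V.induced_map_coset[OF A.linear_map_axioms subspace_reduced_dom image]
  interpret A_ind: linear_map K "Delta_M S (Suc 0)" "Delta_V S (Suc 0)" "A_ind S"
    unfolding A_ind Delta_M_1 Delta_V_1
    by (rule V.linear_map_induced_map[OF A.linear_map_axioms subspace_reduced_dom image])
  have "inj_on (A_ind S) (carrier (Delta_M S (Suc 0)))"
  proof (rule inj_onI)
    fix X Y
    assume "X \<in> carrier (Delta_M S (Suc 0))" "Y \<in> carrier (Delta_M S (Suc 0))" and eq: "A_ind S X = A_ind S Y"
    then obtain x y where x: "x \<in> carrier (dom_sp S)" "X = reduced_dom S +>\<^bsub>dom_sp S\<^esub> x"
      and y: "y \<in> carrier (dom_sp S)" "Y = reduced_dom S +>\<^bsub>dom_sp S\<^esub> y"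
      by (auto simp: Delta_M_1 M.carrier_quot_vs)
    \<comment> \<open>Equality of the image cosets says that \<open>A\<close> maps x - y into V'.
      Since M' is the whole preimage of V', this places x - y in M'.\<close>
    have "A_map S x \<ominus>\<^bsub>cod_sp S\<^esub> A_map S y \<in> reduced_cod S"
      using eq x y by (simp add: A_ind coset V.coset_eq_iff)
    then have "x \<ominus>\<^bsub>dom_sp S\<^esub> y \<in> reduced_dom S"
      using x(1) y(1) A.T_minus E.V.module.M.minus_closed unfolding reduced_dom_def by simp
    then show "X = Y"
      using x y by (simp add: M.coset_eq_iff)
  qed
  moreover have "A_ind.V.fin_dim" "A_ind.W.fin_dim"
    using M.quot_vs_fin_dim(1) V.quot_vs_fin_dim(1) fin_dim by (simp_all add: Delta_M_1 Delta_V_1)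
  ultimately show ?thesis
    unfolding beta1_def One_nat_def using dim_cokernel_vs_inj[OF A_ind.linear_map_axioms] by blast
qed

lemma alpha1_plus_dim_Delta_V:
  "alpha1 K S + vectorspace.dim K (Delta_V S 2) = vectorspace.dim K (Delta_M S (Suc 0))"
proof -
  let ?V' = "(cod_sp S)\<lparr>carrier := reduced_cod S\<rparr>" and ?V'' = "E_map S ` reduced_dom S"
  \<comment> \<open>The codomain of the second reduction is V'' = E M', so its being a subspace of
    V' is the one-step fact for the reduced system.\<close>
  interpret R: linear_system K "reduced S"
    by (rule linear_system.intro[OF is_system_reduced])
  have cod': "cod_sp (reduced S) = ?V'" and V'': "reduced_cod (reduced S) = ?V''"
    by (simp_all add: reduced_def reduced_cod_def)
  have E_ind: "E_ind S = induced_map ?V' ?V'' (E_map S)"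
    by (simp add: E_ind_def iter_reduced_0 iter_reduced_Suc numeral_2_eq_2 cod' reduced_def[of "reduced S"] V'')
  have Delta_V_2: "Delta_V S 2 = quot_vs ?V' ?V''"
    by (simp add: Delta_V_def iter_reduced_0 iter_reduced_Suc numeral_2_eq_2 cod' reduced_def[of "reduced S"] V'')
  interpret V': vs_quotient K ?V' ?V''
    using R.V.vs_quotient_axioms by (simp add: cod' V'')
  \<comment> \<open>The codomain of \<open>E\<close> is narrowed to its image V', so that V'/V''
    becomes a quotient of the codomain.\<close>
  have E: "linear_map K (dom_sp S) ?V' (E_map S)"
    by unfold_locales (auto simp: module_hom_def reduced_cod_def)
  note coset = V'.induced_map_coset[OF E subspace_reduced_dom order_refl]
  interpret E_ind: linear_map K "Delta_M S (Suc 0)" "Delta_V S 2" "E_ind S"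
    unfolding E_ind Delta_M_1 Delta_V_2
    by (rule V'.linear_map_induced_map[OF E subspace_reduced_dom order_refl])
  \<comment> \<open>Every vector of V' is some E x, so every coset of V'' in V' is the image of the
    coset of such an x.\<close>
  have "E_ind S ` carrier (Delta_M S (Suc 0)) = (\<lambda>x. ?V'' +>\<^bsub>?V'\<^esub> E_map S x) ` carrier (dom_sp S)"
    by (simp add: Delta_M_1 M.carrier_quot_vs E_ind image_image coset)
  also have "\<dots> = carrier (Delta_V S 2)"
    unfolding Delta_V_2 V'.carrier_quot_vs by (simp add: image_image reduced_cod_def)
  finally have surj: "E_ind S ` carrier (Delta_M S (Suc 0)) = carrier (Delta_V S 2)" .
  have "E_ind.V.fin_dim"
    using M.quot_vs_fin_dim(1) fin_dim by (simp add: Delta_M_1)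
  then show ?thesis
    unfolding alpha1_def One_nat_def using dim_kernel_vs_surj[OF E_ind.linear_map_axioms _ surj] by blast
qed

section \<open>All stages of the reduction, and stabilisation of the dimensions\<close>

lemma is_system_iter_reduced: "is_system K (iter_reduced S j)"
proof (induction j)
  case (Suc j)
  then interpret R: linear_system K "iter_reduced S j" by (rule linear_system.intro)
  show ?case using R.is_system_reduced by (simp add: iter_reduced_Suc)
qed (simp add: iter_reduced_0 system)

lemma beta_plus_dim_Delta_M:
  assumes "j \<ge> 1"
  shows "beta K S j + vectorspace.dim K (Delta_M S j) = vectorspace.dim K (Delta_V S j)"
proof -
  interpret R: linear_system K "iter_reduced S (j - 1)"
    by (rule linear_system.intro[OF is_system_iter_reduced])
  \<comment> \<open>As \<open>j \<ge> 1\<close>, the truncated \<open>j - 1\<close> is a true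
    predecessor, so the first quotients of stage \<open>j - 1\<close> are the \<open>j\<close>-th
    quotients of \<open>S\<close>.\<close>
  have "Delta_M (iter_reduced S (j - 1)) (Suc 0) = Delta_M S j" "Delta_V (iter_reduced S (j - 1)) (Suc 0) = Delta_V S j"
    using assms by (simp_all add: Delta_M_def Delta_V_def iter_reduced_add)
  then show ?thesis using R.beta1_plus_dim_Delta_M by (simp add: beta_def)
qed

lemma alpha_plus_dim_Delta_V:
  assumes "j \<ge> 1"
  shows "alpha K S j + vectorspace.dim K (Delta_V S (j + 1)) = vectorspace.dim K (Delta_M S j)"
proof -
  interpret R: linear_system K "iter_reduced S (j - 1)"
    by (rule linear_system.intro[OF is_system_iter_reduced])
  have "Delta_M (iter_reduced S (j - 1)) (Suc 0) = Delta_M S j"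
    "Delta_V (iter_reduced S (j - 1)) 2 = Delta_V S (j + 1)"
    using assms by (simp_all add: Delta_M_def Delta_V_def iter_reduced_add)
  then show ?thesis using R.alpha1_plus_dim_Delta_V by (simp add: alpha_def)
qed

lemma dim_Delta_V_plus_dim_V_iter:
  "vectorspace.dim K (Delta_V S (Suc j)) + vectorspace.dim K (V_iter S (Suc j))
    = vectorspace.dim K (V_iter S j)"
proof -
  interpret R: linear_system K "iter_reduced S j"
    by (rule linear_system.intro[OF is_system_iter_reduced])
  show ?thesis
    using R.V.quot_vs_fin_dim(2)[OF R.fin_dim(2)]
    by (simp add: Delta_V_def iter_reduced_Suc reduced_def[of "iter_reduced S j"])
qed

text \<open>The dimensions of the \<open>V_iter S j\<close> form a nonincreasing sequence of
  naturals, constant once its minimum is reached. The dimension of \<open>Delta_V\<close> is the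
  drop between consecutive terms.\<close>

lemma eventually_dim_Delta_V_eq_0: "\<exists>n. \<forall>j\<ge>n. vectorspace.dim K (Delta_V S j) = 0"
proof -
  define v where "v j = vectorspace.dim K (V_iter S j)" for j
  have step: "vectorspace.dim K (Delta_V S (Suc j)) + v (Suc j) = v j" for j
    unfolding v_def by (rule dim_Delta_V_plus_dim_V_iter)
  have "v (Suc j) \<le> v j" for j
    using step[of j] by linarith
  then have v: "v j \<le> v i" if "i \<le> j" for i j
    using lift_Suc_antimono_le[of v i j] that by blast
  obtain n where n: "v n \<le> v j" for j
    using arg_min_nat_le[of "\<lambda>_. True" _ v] by blast
  \<comment> \<open>The threshold is \<open>Suc n\<close> because the quotient with index
    \<open>j\<close> compares stages \<open>j - 1\<close> and \<open>j\<close>, and both must lie at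
    or beyond the minimum.\<close>
  have "vectorspace.dim K (Delta_V S j) = 0" if j: "j \<ge> Suc n" for j
  proof -
    obtain i where i: "j = Suc i" "n \<le> i" using j by (cases j) auto
    then show ?thesis using n[of "Suc i"] v[OF i(2)] step[of i] unfolding i(1) by linarith
  qed
  then show ?thesis by blast
qed

end

section \<open>Telescoping series of natural numbers and the two formulas\<close>

lemma has_sum_telescope_nat:
  fixes f d :: "nat \<Rightarrow> nat"
  assumes step: "\<And>j. j \<ge> k \<Longrightarrow> f j + d (j + 1) = d j" and zero: "\<And>j. j \<ge> n \<Longrightarrow> d j = 0"
  shows "(f has_sum d k) {k..}"
proof -
  \<comment> \<open>From \<open>m\<close> on \<open>d\<close> vanishes, and \<open>m \<ge> k\<close>
    lets the finite telescoping identity be used at \<open>m\<close>.\<close>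
  define m where "m = max k n"
  have sum: "sum f {k..<i} + d i = d k" if "i \<ge> k" for i
    using that
  proof (induction i rule: dec_induct)
    case (step i)
    then show ?case using assms(1)[of i] by simp
  qed simp
  have "(f has_sum sum f {k..<m}) {k..<m}" by (rule has_sum_finite) simp
  \<comment> \<open>Beyond \<open>m\<close> the naturals \<open>f j\<close> and
    \<open>d (j + 1)\<close> add up to \<open>d j = 0\<close>, so the finite sum is already the
    infinite one.\<close>
  moreover have "f j = 0" if "j \<in> {k..} - {k..<m}" for j
    using that step[of j] zero[of j] by (auto simp: m_def)
  ultimately have "(f has_sum sum f {k..<m}) {k..}"
    by (subst has_sum_cong_neutral[of "{k..<m}" "{k..}" f f]) auto
  then show ?thesis using sum[of m] zero[of m] by (simp add: m_def)
qed

theorem lemma3p13: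
  fixes K :: "('a, 'k) ring_scheme"
    and S :: "('a, 'm, 'v) system"
    and k :: nat
  assumes "field K" and "is_system K S" and "k \<ge> 1"
  shows "((\<lambda>j. alpha K S j + beta K S j) has_sum vectorspace.dim K (Delta_V S k)) {k..}
       \<and> ((\<lambda>j. alpha K S j + beta K S (j + 1)) has_sum vectorspace.dim K (Delta_M S k)) {k..}"
proof -
  interpret linear_system K S using assms(2) by (rule linear_system.intro)
  obtain n where n: "\<And>j. j \<ge> n \<Longrightarrow> vectorspace.dim K (Delta_V S j) = 0"
    using eventually_dim_Delta_V_eq_0 by blast
  show ?thesis
  proof (intro conjI has_sum_telescope_nat)
    fix j assume "j \<ge> k"
    then have j: "j \<ge> 1" using \<open>k \<ge> 1\<close> by simp
    \<comment> \<open>Here the dimension of \<open>Delta_M S j\<close> is eliminated between the two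
      identities at \<open>j\<close>.\<close>
    show "alpha K S j + beta K S j + vectorspace.dim K (Delta_V S (j + 1)) = vectorspace.dim K (Delta_V S j)"
      using alpha_plus_dim_Delta_V[OF j] beta_plus_dim_Delta_M[OF j] by simp
    \<comment> \<open>Here the dimension of \<open>Delta_V S (j + 1)\<close> is eliminated, which is
      why \<open>beta\<close> enters with the shifted index.\<close>
    show "alpha K S j + beta K S (j + 1) + vectorspace.dim K (Delta_M S (j + 1)) = vectorspace.dim K (Delta_M S j)"
      using alpha_plus_dim_Delta_V[OF j] beta_plus_dim_Delta_M[of "j + 1"] by simp
  next
    fix j assume "j \<ge> n"
    then show "vectorspace.dim K (Delta_V S j) = 0" by (rule n)
  next
    \<comment> \<open>The dimension of \<open>Delta_M S j\<close> is at most that of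
      \<open>Delta_V S j\<close> by the \<open>beta\<close> identity, which is available only for
      \<open>j \<ge> 1\<close>; hence the maximum with 1.\<close>
    fix j assume "j \<ge> max n 1"
    then show "vectorspace.dim K (Delta_M S j) = 0"
      using n[of j] beta_plus_dim_Delta_M[of j] by simp
  qed
qed

end
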